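(* Let $X,Y$ be complex Banach spaces and let $A\in\mathcal{L}(X,Y)$ and $B,C\in\mathcal{L}(Y,X)$ be such that $A(BA)^2=ABACA=ACABA=(AC)^2A$. Then $H_0(AC)$ is closed if and only if $H_0(BA)$ is closed.
   Context: $\mathcal{L}(X,Y)$ is the set of bounded linear operators from $X$ to $Y$, and $\mathcal{L}(X)=\mathcal{L}(X,X)$. For $T\in\mathcal{L}(X)$, the quasinilpotent part of $T$ is $H_0(T)=\{x\in X:\lim_{n\to\infty}\|T^nx\|^{1/n}=0\}$. *)

theory Defs
  imports "HOL-Analysis.Analysis"
begin

text \<open>
  Complex normed spaces: a real normed space whose scalar multiplication extends to the complex
  numbers, so that the norm, the topology and completeness are those of the existing class
  hierarchy.
\<close>

class complex_normed_vector = real_normed_vector +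
  fixes scaleC :: "complex \<Rightarrow> 'a \<Rightarrow> 'a" (infixr \<open>*\<^sub>C\<close> 75)
  assumes scaleC_add_right: "a *\<^sub>C (x + y) = a *\<^sub>C x + a *\<^sub>C y"
    and scaleC_add_left: "(a + b) *\<^sub>C x = a *\<^sub>C x + b *\<^sub>C x"
    and scaleC_scaleC: "a *\<^sub>C (b *\<^sub>C x) = (a * b) *\<^sub>C x"
    and scaleC_one: "1 *\<^sub>C x = x"
    and scaleR_scaleC: "r *\<^sub>R x = complex_of_real r *\<^sub>C x"
    and norm_scaleC: "norm (a *\<^sub>C x) = cmod a * norm x"

class complex_banach = complex_normed_vector + complete_space

subclass (in complex_banach) banach ..

instantiation complex :: complex_banach
begin

definition scaleC_complex :: "complex \<Rightarrow> complex \<Rightarrow> complex" where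
  "scaleC_complex a x = a * x"

instance
  by standard
    (simp_all add: scaleC_complex_def algebra_simps norm_mult scaleR_conv_of_real)

end

definition bounded_clinear ::
    "('a::complex_normed_vector \<Rightarrow> 'b::complex_normed_vector) \<Rightarrow> bool" where
  "bounded_clinear f \<longleftrightarrow> bounded_linear f \<and> (\<forall>c x. f (c *\<^sub>C x) = c *\<^sub>C f x)"

text \<open>
  The term with \<open>n = 0\<close>, where \<open>root 0 y = 0\<close> by convention, does not affect the limit.
\<close>

definition quasinilpotent_part :: "('a::real_normed_vector \<Rightarrow> 'a) \<Rightarrow> 'a set" where
  "quasinilpotent_part T = {x. (\<lambda>n. root n (norm ((T ^^ n) x))) \<longlonglongrightarrow> 0}"

end

theory Submission
  imports Defs
begin

text \<open>
  Write \<open>S = A C\<close>, \<open>T = B A\<close> and \<open>H\<^sub>0\<close> for the quasinilpotent part. Closedness passes between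
  \<open>S\<close> and \<open>T\<close> because each quasinilpotent part is the preimage of the other under a bounded operator:
  \<open>H\<^sub>0(T)\<close> is the preimage of \<open>H\<^sub>0(S)\<close> under \<open>A\<close>, and \<open>H\<^sub>0(S)\<close> is the preimage of \<open>H\<^sub>0(T)\<close> under \<open>C\<close>.

  The first identity rests on \<open>S\<^sup>n A = A T\<^sup>n\<close>, which the hypotheses give for \<open>n \<ge> 2\<close> (though not for
  \<open>n = 1\<close>): the orbit of \<open>A x\<close> under \<open>S\<close> is eventually the image under \<open>A\<close> of the orbit of
  \<open>x\<close> under \<open>T\<close>, and conversely \<open>B\<close> sends it back to the orbit of \<open>x\<close>, shifted by one, since
  \<open>B A T\<^sup>n = T\<^bsup>n+1\<^esup>\<close>. Membership in \<open>H\<^sub>0\<close> survives a bounded operator and an index shift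
  (\<open>quasinilpotent_part_transfer\<close>). The second identity follows from the first:
  \<open>y\<close> lies in \<open>H\<^sub>0(S)\<close> iff \<open>S y = A (C y)\<close> does, which holds iff \<open>C y\<close> lies in \<open>H\<^sub>0(T)\<close>.
\<close>

text \<open>
  Having root limit zero means decaying faster than every geometric sequence. In this form
  constant factors and index shifts are harmless, because both are absorbed into \<open>K\<close>.
\<close>

lemma quasinilpotent_part_iff_geometric_bound:
  "x \<in> quasinilpotent_part T \<longleftrightarrow>
    (\<forall>e>0. \<exists>K. \<forall>\<^sub>F n in sequentially. norm ((T ^^ n) x) \<le> K * e ^ n)"
    (is "_ \<longleftrightarrow> ?R")
proof
  assume "x \<in> quasinilpotent_part T"
  then have lim: "(\<lambda>n. root n (norm ((T ^^ n) x))) \<longlonglongrightarrow> 0"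
    by (simp add: quasinilpotent_part_def)
  show ?R
  proof (intro allI impI)
    fix e :: real assume "e > 0"
    then have "\<forall>\<^sub>F n in sequentially. root n (norm ((T ^^ n) x)) < e"
      using lim by (rule order_tendstoD(2)[rotated])
    then have "\<forall>\<^sub>F n in sequentially. norm ((T ^^ n) x) \<le> 1 * e ^ n"
      using eventually_gt_at_top[of 0]
    proof eventually_elim
      case (elim n)
      have "norm ((T ^^ n) x) = root n (norm ((T ^^ n) x)) ^ n"
        using elim by simp
      also have "\<dots> \<le> e ^ n"
        using elim by (intro power_mono) simp_all
      finally show ?case by simp
    qed
    then show "\<exists>K. \<forall>\<^sub>F n in sequentially. norm ((T ^^ n) x) \<le> K * e ^ n"
      by blast
  qed
next
  assume R: ?R
  have "(\<lambda>n. root n (norm ((T ^^ n) x))) \<longlonglongrightarrow> 0"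
  proof (rule order_tendstoI)
    fix a :: real assume "a < 0"
    then show "\<forall>\<^sub>F n in sequentially. a < root n (norm ((T ^^ n) x))"
      by (intro always_eventually allI less_le_trans[OF _ real_root_ge_zero]) simp_all
  next
    fix a :: real assume "0 < a"
    \<comment> \<open>Since \<open>root n K\<close> tends to 1, the geometric bound with ratio \<open>a / 2\<close> leaves room below \<open>a\<close>;
        the constant is first made positive so that this limit applies.\<close>
    then obtain K where K: "\<forall>\<^sub>F n in sequentially. norm ((T ^^ n) x) \<le> K * (a / 2) ^ n"
      using R half_gt_zero by blast
    define K' where "K' = max K 1"
    have "K' > 0" by (simp add: K'_def)
    then have "(\<lambda>n. root n K') \<longlonglongrightarrow> 1"
      by (rule LIMSEQ_root_const)
    then have "\<forall>\<^sub>F n in sequentially. root n K' < 2"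
      by (rule order_tendstoD(2)) simp
    with K show "\<forall>\<^sub>F n in sequentially. root n (norm ((T ^^ n) x)) < a"
      using eventually_gt_at_top[of 0]
    proof eventually_elim
      case (elim n)
      have "norm ((T ^^ n) x) \<le> K' * (a / 2) ^ n"
        using \<open>0 < a\<close> by (intro order_trans[OF elim(1)]) (simp add: K'_def mult_right_mono)
      then have "root n (norm ((T ^^ n) x)) \<le> root n (K' * (a / 2) ^ n)"
        using elim by simp
      also have "\<dots> = root n K' * (a / 2)"
        using elim \<open>0 < a\<close> by (simp add: real_root_mult real_root_power_cancel)
      also have "\<dots> < 2 * (a / 2)"
        using elim \<open>0 < a\<close> by (intro mult_strict_right_mono) simp_all
      finally show ?case by simp
    qed
  qed
  then show "x \<in> quasinilpotent_part T"
    by (simp add: quasinilpotent_part_def)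
qed

lemma quasinilpotent_part_transfer:
  assumes "bounded_linear L"
    and orbit: "\<forall>\<^sub>F n in sequentially. (S ^^ (n + k)) y = L ((T ^^ n) x)"
    and x: "x \<in> quasinilpotent_part T"
  shows "y \<in> quasinilpotent_part S"
  unfolding quasinilpotent_part_iff_geometric_bound
proof (intro allI impI)
  fix e :: real assume "e > 0"
  obtain M where M: "M > 0" "\<And>z. norm (L z) \<le> norm z * M"
    using bounded_linear.pos_bounded[OF \<open>bounded_linear L\<close>] by blast
  obtain K where K: "\<forall>\<^sub>F n in sequentially. norm ((T ^^ n) x) \<le> K * e ^ n"
    using x \<open>e > 0\<close> unfolding quasinilpotent_part_iff_geometric_bound by blast
  from K orbit
  have "\<forall>\<^sub>F n in sequentially. norm ((S ^^ (n + k)) y) \<le> K * M / e ^ k * e ^ (n + k)"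
  proof eventually_elim
    case (elim n)
    have "norm ((S ^^ (n + k)) y) \<le> norm ((T ^^ n) x) * M"
      using elim(2) M(2) by simp
    also have "\<dots> \<le> K * e ^ n * M"
      using elim(1) M(1) by (intro mult_right_mono) simp_all
    also have "\<dots> = K * M / e ^ k * e ^ (n + k)"
      using \<open>e > 0\<close> by (simp add: power_add)
    finally show ?case .
  qed
  then have "\<forall>\<^sub>F n in sequentially. norm ((S ^^ n) y) \<le> K * M / e ^ k * e ^ n"
    by (rule eventually_sequentially_seg[THEN iffD1])
  then show "\<exists>K. \<forall>\<^sub>F n in sequentially. norm ((S ^^ n) y) \<le> K * e ^ n"
    by blast
qed

lemma quasinilpotent_part_apply_iff:
  assumes "bounded_linear S"
  shows "S y \<in> quasinilpotent_part S \<longleftrightarrow> y \<in> quasinilpotent_part S"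
proof
  assume "S y \<in> quasinilpotent_part S"
  then show "y \<in> quasinilpotent_part S"
    by (rule quasinilpotent_part_transfer[OF bounded_linear_ident, where k = 1, rotated])
      (simp add: funpow_swap1)
next
  assume "y \<in> quasinilpotent_part S"
  then show "S y \<in> quasinilpotent_part S"
    by (rule quasinilpotent_part_transfer[OF assms, where k = 0, rotated])
      (simp add: funpow_swap1)
qed

text \<open>
  From the second power on, a factor \<open>S\<close> can be pulled through \<open>A\<close>: the relation \<open>A C A B A = A B A B A\<close>
  converts the newest \<open>C\<close> into a \<open>B\<close>, but only when it is followed by a further factor \<open>B A\<close>. Hence
  the induction starts at \<open>n = 2\<close>, where the relation \<open>A C A C A = A B A B A\<close> is the base.
\<close>

lemma funpow_intertwine:
  assumes SSA: "\<And>x. A (C (A (C (A x)))) = A (B (A (B (A x))))"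
    and SPA: "\<And>x. A (C (A (B (A x)))) = A (B (A (B (A x))))"
    and "n \<ge> 2"
  shows "((A \<circ> C) ^^ n) (A x) = A (((B \<circ> A) ^^ n) x)"
  using \<open>n \<ge> 2\<close>
proof (induction n rule: dec_induct)
  case base
  then show ?case by (simp add: numeral_2_eq_2 SSA)
next
  case (step n)
  then obtain m where n: "n = Suc m"
    by (cases n) simp_all
  have "((A \<circ> C) ^^ Suc n) (A x) = A (C (A (((B \<circ> A) ^^ n) x)))"
    using step.IH by (metis comp_apply funpow.simps(2))
  also have "\<dots> = A (C (A (B (A (((B \<circ> A) ^^ m) x)))))"
    by (simp add: n)
  also have "\<dots> = A (B (A (B (A (((B \<circ> A) ^^ m) x)))))"
    by (rule SPA)
  also have "\<dots> = A (((B \<circ> A) ^^ Suc n) x)"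
    by (simp add: n)
  finally show ?case .
qed

theorem theorem3p7:
  fixes A :: "'x::complex_banach \<Rightarrow> 'y::complex_banach"
    and B C :: "'y \<Rightarrow> 'x"
  assumes "bounded_clinear A" and "bounded_clinear B" and "bounded_clinear C"
    and "A \<circ> (B \<circ> A) ^^ 2 = A \<circ> B \<circ> A \<circ> C \<circ> A"
    and "A \<circ> B \<circ> A \<circ> C \<circ> A = A \<circ> C \<circ> A \<circ> B \<circ> A"
    and "A \<circ> C \<circ> A \<circ> B \<circ> A = (A \<circ> C) ^^ 2 \<circ> A"
  shows "closed (quasinilpotent_part (A \<circ> C)) \<longleftrightarrow> closed (quasinilpotent_part (B \<circ> A))"
proof -
  let ?S = "A \<circ> C" and ?T = "B \<circ> A"
  have A: "bounded_linear A" and B: "bounded_linear B" and C: "bounded_linear C"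
    using assms(1-3) by (simp_all add: bounded_clinear_def)
  have S: "bounded_linear ?S"
    using bounded_linear_compose[OF A C] by (simp add: comp_def)
  have SPA: "A (C (A (B (A x)))) = A (B (A (B (A x))))" for x
    using fun_cong[OF assms(4), of x] fun_cong[OF assms(5), of x] by (simp add: numeral_2_eq_2)
  have SSA: "A (C (A (C (A x)))) = A (B (A (B (A x))))" for x
    using fun_cong[OF assms(6), of x] SPA[of x] by (simp add: numeral_2_eq_2)
  have intertwine: "\<forall>\<^sub>F n in sequentially. (?S ^^ n) (A x) = A ((?T ^^ n) x)" for x
    using eventually_ge_at_top[of 2] by eventually_elim (rule funpow_intertwine[OF SSA SPA])
  have A_iff: "A x \<in> quasinilpotent_part ?S \<longleftrightarrow> x \<in> quasinilpotent_part ?T" for x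
  proof
    assume "x \<in> quasinilpotent_part ?T"
    then show "A x \<in> quasinilpotent_part ?S"
      by (rule quasinilpotent_part_transfer[OF A, where k = 0, rotated])
        (simp add: intertwine)
  next
    assume *: "A x \<in> quasinilpotent_part ?S"
    have "\<forall>\<^sub>F n in sequentially. (?T ^^ (n + 1)) x = B ((?S ^^ n) (A x))"
      using intertwine[of x] by eventually_elim simp
    then show "x \<in> quasinilpotent_part ?T"
      using * by (rule quasinilpotent_part_transfer[OF B])
  qed
  have C_iff: "C y \<in> quasinilpotent_part ?T \<longleftrightarrow> y \<in> quasinilpotent_part ?S" for y
    using A_iff[of "C y"] quasinilpotent_part_apply_iff[OF S, of y] by simp
  have "quasinilpotent_part ?T = A -` quasinilpotent_part ?S"
    and "quasinilpotent_part ?S = C -` quasinilpotent_part ?T"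
    using A_iff C_iff by auto
  moreover have "closed (A -` F)" if "closed F" for F
    using that by (rule closed_vimage) (rule linear_continuous_on[OF A])
  moreover have "closed (C -` F)" if "closed F" for F
    using that by (rule closed_vimage) (rule linear_continuous_on[OF C])
  ultimately show ?thesis
    by metis
qed

end
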